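(* Let $\varepsilon\in(0,1]$, let $k\ge1$ be an integer, let $C>0$, and let $f$ be an effort function. Suppose every worker is assigned $k$ tasks, the penalty cost equals $C$, and the probability $p\in[0,1]$ of being verified by the supervisor satisfies $$p>\frac{(-f'(\varepsilon))\,k}{C}.$$ Then workers minimize their loss by playing a truthful strategy: any error probability $e^*\in(0,1]$ minimizing the worker's expected loss satisfies $e^*<\varepsilon$.
   Context: Effort function: a function $f:(0,1]\to[0,+\infty)$ that is monotonically decreasing, differentiable and strictly convex; performing a task with error probability $e$ (probability of reporting an incorrect solution) costs effort $f(e)$. A worker's strategy is the choice of an error probability $e\in(0,1]$, used on all its tasks; it is truthful if $e<\varepsilon$. One-level supervision: with probability $p$ a worker is verified by the supervisor, who checks one of the worker's tasks, always knows the correct solution (the supervisor makes no mistakes), and imposes a penalty $C$ if the worker's solution on this task is incorrect and $0$ otherwise. Thus the worker's expected loss is $L(e)=k f(e)+e\,p\,C$. *)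

theory Defs
  imports "HOL-Probability.Probability"
begin

definition strictly_convex_on :: "real set \<Rightarrow> (real \<Rightarrow> real) \<Rightarrow> bool" where
  "strictly_convex_on S f \<longleftrightarrow> convex S \<and>
     (\<forall>x\<in>S. \<forall>y\<in>S. \<forall>u. x \<noteq> y \<and> 0 < u \<and> u < 1 \<longrightarrow>
        f ((1 - u) * x + u * y) < (1 - u) * f x + u * f y)"

definition strategies :: "real set" where
  "strategies = {0<..1}"

text \<open>Only the values of \<open>f\<close> on the half-open unit interval matter; in particular
  differentiability at the end point 1 is one-sided.\<close>

definition effort_function :: "(real \<Rightarrow> real) \<Rightarrow> bool" where
  "effort_function f \<longleftrightarrow>
     (\<forall>e\<in>strategies. 0 \<le> f e) \<and>
     antimono_on strategies f \<and>
     f differentiable_on strategies \<and>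
     strictly_convex_on strategies f"

definition effort_deriv :: "(real \<Rightarrow> real) \<Rightarrow> real \<Rightarrow> real" where
  "effort_deriv f e = vector_derivative f (at e within strategies)"

lemma effort_deriv_works:
  assumes "effort_function f" "e \<in> strategies"
  shows "(f has_real_derivative effort_deriv f e) (at e within strategies)"
  using assms
  by (auto simp: effort_function_def effort_deriv_def differentiable_on_def
      has_real_derivative_iff_has_vector_derivative vector_derivative_works[symmetric])

definition truthful :: "real \<Rightarrow> real \<Rightarrow> bool" where
  "truthful \<epsilon> e \<longleftrightarrow> e < \<epsilon>"

text \<open>The worker is verified with probability \<open>p\<close>; independently of this, the checked task is
  answered incorrectly with probability \<open>e\<close>. The infallible supervisor imposes the penalty
  \<open>C\<close> exactly if both happen. Every task has the same error probability, so it does not matter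
  which of them is checked.\<close>

definition penalty_pmf :: "real \<Rightarrow> real \<Rightarrow> real \<Rightarrow> real pmf" where
  "penalty_pmf C p e =
     bind_pmf (bernoulli_pmf p) (\<lambda>verified.
       map_pmf (\<lambda>incorrect. if verified \<and> incorrect then C else 0) (bernoulli_pmf e))"

definition expected_loss ::
  "(real \<Rightarrow> real) \<Rightarrow> nat \<Rightarrow> real \<Rightarrow> real \<Rightarrow> real \<Rightarrow> real" where
  "expected_loss f k C p e =
     real k * f e + measure_pmf.expectation (penalty_pmf C p e) (\<lambda>c. c)"

lemma expected_loss_eq:
  assumes "0 \<le> p" "p \<le> 1" "e \<in> strategies"
  shows "expected_loss f k C p e = real k * f e + e * p * C"
proof -
  have e: "0 \<le> e" "e \<le> 1"
    using assms(3) by (auto simp: strategies_def)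
  have "measure_pmf.expectation (penalty_pmf C p e) (\<lambda>c. c) =
      (\<Sum>v\<in>UNIV. pmf (bernoulli_pmf p) v *\<^sub>R measure_pmf.expectation
          (map_pmf (\<lambda>w. if v \<and> w then C else 0) (bernoulli_pmf e)) (\<lambda>c. c))"
    unfolding penalty_pmf_def by (rule pmf_expectation_bind) auto
  also have "\<dots> = e * p * C"
    using assms(1,2) e by (simp add: UNIV_bool)
  finally show ?thesis
    by (simp add: expected_loss_def)
qed

end

theory Submission
  imports Defs
begin

text \<open>The loss has positive derivative \<open>k f'(\<epsilon>) + p C\<close> at \<open>\<epsilon>\<close>. Hence playing slightly below \<open>\<epsilon>\<close>
  beats \<open>\<epsilon>\<close> itself, and since the convex function \<open>f\<close> lies above its tangent at \<open>\<epsilon>\<close>, playing \<open>\<epsilon>\<close>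
  beats every larger error probability.\<close>

text \<open>Coinciding points, which the strict inequality excludes, give equality. Plain convexity
  is what the tangent inequality asks for.\<close>

lemma strictly_convex_on_imp_convex_on:
  assumes "strictly_convex_on S f"
  shows "convex_on S f"
proof (rule convex_onI)
  fix t x y :: real
  assume "0 < t" "t < 1" "x \<in> S" "y \<in> S"
  then show "f ((1 - t) *\<^sub>R x + t *\<^sub>R y) \<le> (1 - t) * f x + t * f y"
    using assms unfolding strictly_convex_on_def real_scaleR_def
    by (cases "x = y") (simp add: algebra_simps, blast intro: less_imp_le)
qed (use assms in \<open>simp add: strictly_convex_on_def\<close>)

theorem theorem1:
  fixes f :: "real \<Rightarrow> real" and k :: nat and \<epsilon> C p :: real
  assumes "\<epsilon> \<in> {0<..1}"
    and "k \<ge> 1"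
    and "C > 0"
    and "effort_function f"
    and "p \<in> {0..1}"
    and "p > (- effort_deriv f \<epsilon>) * real k / C"
  shows "\<forall>e. is_arg_min (expected_loss f k C p) (\<lambda>e. e \<in> strategies) e \<longrightarrow> truthful \<epsilon> e"
proof (intro allI impI)
  fix e
  assume "is_arg_min (expected_loss f k C p) (\<lambda>e. e \<in> strategies) e"
  then have e: "e \<in> strategies"
    and min: "\<And>x. x \<in> strategies \<Longrightarrow> expected_loss f k C p e \<le> expected_loss f k C p x"
    by (auto simp: is_arg_min_linorder)
  \<comment> \<open>Agreement with \<open>expected_loss\<close> is available on
    \<open>strategies\<close>, which suffices to transfer minimality.\<close>
  define L where "L x = real k * f x + x * p * C" for x
  have minL: "L e \<le> L x" if "x \<in> strategies" for x
    using min[OF that] e that assms(5) by (simp add: expected_loss_eq L_def)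
  have \<epsilon>: "\<epsilon> \<in> strategies"
    using assms(1) by (simp add: strategies_def)
  define D where "D = real k * effort_deriv f \<epsilon> + p * C"
  \<comment> \<open>The bound on \<open>p\<close>, multiplied by \<open>C\<close>.\<close>
  have "D > 0"
    using assms(3,6) by (simp add: D_def field_simps)
  have f': "(f has_real_derivative effort_deriv f \<epsilon>) (at \<epsilon> within strategies)"
    using effort_deriv_works[OF assms(4) \<epsilon>] .
  have L': "(L has_real_derivative D) (at \<epsilon> within strategies)"
    unfolding L_def D_def by (auto intro!: derivative_eq_intros f')
  consider "e < \<epsilon>" | "e = \<epsilon>" | "e > \<epsilon>"
    by linarith
  then show "truthful \<epsilon> e"
  proof cases
    case 1
    then show ?thesis
      by (simp add: truthful_def)
  next
    case 2
    \<comment> \<open>Only points to the left are compared, so the one-sided derivative at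
      \<epsilon> = 1 is covered too.\<close>
    obtain d where "d > 0" and d: "\<And>h. 0 < h \<Longrightarrow> \<epsilon> - h \<in> strategies \<Longrightarrow> h < d \<Longrightarrow> L (\<epsilon> - h) < L \<epsilon>"
      using has_real_derivative_pos_inc_left[OF L' \<open>D > 0\<close>] by blast
    \<comment> \<open>Halving gives \<open>h < d\<close> and keeps \<epsilon> - h positive.\<close>
    define h where "h = min d \<epsilon> / 2"
    have "0 < h" "h < d" "\<epsilon> - h \<in> strategies"
      using \<open>d > 0\<close> assms(1) by (auto simp: h_def strategies_def min_def)
    with d minL[of "\<epsilon> - h"] 2 show ?thesis
      by fastforce
  next
    case 3
    \<comment> \<open>Here \<epsilon> < e \<le> 1, so \<epsilon> is not the end point 1.\<close>
    with e assms(1) have "\<epsilon> \<in> interior strategies"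
      by (simp add: strategies_def)
    moreover have "convex_on strategies f"
      using assms(4) by (simp add: effort_function_def strictly_convex_on_imp_convex_on)
    ultimately have "f e - f \<epsilon> \<ge> effort_deriv f \<epsilon> * (e - \<epsilon>)"
      by (intro convex_on_imp_above_tangent[where A = strategies] e f')
        (simp_all add: strategies_def)
    then have "real k * (effort_deriv f \<epsilon> * (e - \<epsilon>)) \<le> real k * (f e - f \<epsilon>)"
      by (intro mult_left_mono) simp_all
    \<comment> \<open>The penalty is linear in the error probability, so adding it to both sides
      turns the tangent bound for \<open>f\<close> into one for \<open>L\<close>.\<close>
    then have "D * (e - \<epsilon>) \<le> L e - L \<epsilon>"
      by (simp add: L_def D_def algebra_simps)
    moreover have "0 < D * (e - \<epsilon>)"
      using \<open>D > 0\<close> 3 by simp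
    ultimately show ?thesis
      using minL[OF \<epsilon>] by linarith
  qed
qed

end
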